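(* Let $n\ge 2$ and $k$ be positive integers with $k\ge n-1$. Then $\mathit{ghn}(K(2n+k,n))=2$ if $k>2$, and $\mathit{ghn}(K(2n+k,n))=3$ if $k\le 2$.
   Context: For positive integers $n,k$, the Kneser graph $K(2n+k,n)$ has as vertex set all $n$-element subsets of $\{1,\ldots,2n+k\}$, two vertices $u,v$ being adjacent iff $u\cap v=\emptyset$. For vertices $u,v$, $I[u,v]$ is the set of all vertices on some shortest $u$–$v$ path; for $W\subseteq V$, $I[W]=\bigcup_{u,v\in W}I[u,v]$. $W$ is geodetically convex if $I[W]=W$; the geodetic hull $H[W]$ is the smallest geodetically convex set containing $W$; $W$ is a geodetic hull set if $H[W]=V$; the geodetic hull number $\mathit{ghn}(G)$ is the minimum size of a geodetic hull set. *)

theory Defs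
  imports "Graph_Theory.Graph_Theory"
begin

text \<open>Undirected simple graphs are represented as symmetric loop-free digraphs of
  \<^theory>\<open>Graph_Theory.Digraph\<close>; paths are lists of distinct vertices.\<close>

definition kneser_graph :: "nat \<Rightarrow> nat \<Rightarrow> nat set pair_pre_digraph" where
  "kneser_graph N n =
    \<lparr> pverts = {u. u \<subseteq> {1..N} \<and> card u = n},
      parcs = {(u, v). u \<subseteq> {1..N} \<and> card u = n \<and> v \<subseteq> {1..N} \<and> card v = n \<and> u \<inter> v = {}} \<rparr>"

definition path_betw :: "('a, 'b) pre_digraph \<Rightarrow> 'a \<Rightarrow> 'a list \<Rightarrow> 'a \<Rightarrow> bool" where
  "path_betw G u p v \<longleftrightarrow> vpath p G \<and> hd p = u \<and> last p = v"

definition shortest_path :: "('a, 'b) pre_digraph \<Rightarrow> 'a \<Rightarrow> 'a list \<Rightarrow> 'a \<Rightarrow> bool" where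
  "shortest_path G u p v \<longleftrightarrow>
    path_betw G u p v \<and> (\<forall>q. path_betw G u q v \<longrightarrow> vwalk_length p \<le> vwalk_length q)"

definition geodetic_interval :: "('a, 'b) pre_digraph \<Rightarrow> 'a \<Rightarrow> 'a \<Rightarrow> 'a set" where
  "geodetic_interval G u v = {w. \<exists>p. shortest_path G u p v \<and> w \<in> set p}"

definition geodetic_closure :: "('a, 'b) pre_digraph \<Rightarrow> 'a set \<Rightarrow> 'a set" where
  "geodetic_closure G W = (\<Union>u\<in>W. \<Union>v\<in>W. geodetic_interval G u v)"

definition geodetically_convex :: "('a, 'b) pre_digraph \<Rightarrow> 'a set \<Rightarrow> bool" where
  "geodetically_convex G W \<longleftrightarrow> W \<subseteq> verts G \<and> geodetic_closure G W = W"

definition geodetic_hull :: "('a, 'b) pre_digraph \<Rightarrow> 'a set \<Rightarrow> 'a set" where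
  "geodetic_hull G W = \<Inter>{C. geodetically_convex G C \<and> W \<subseteq> C}"

definition geodetic_hull_set :: "('a, 'b) pre_digraph \<Rightarrow> 'a set \<Rightarrow> bool" where
  "geodetic_hull_set G W \<longleftrightarrow> W \<subseteq> verts G \<and> geodetic_hull G W = verts G"

definition ghn :: "('a, 'b) pre_digraph \<Rightarrow> nat" where
  "ghn G = (LEAST m. \<exists>W. geodetic_hull_set G W \<and> finite W \<and> card W = m)"

lemma pair_graph_kneser_graph:
  assumes "n > 0"
  shows "pair_graph (kneser_graph N n)"
proof -
  have fin: "finite (pverts (kneser_graph N n))"
    by (rule finite_subset[of _ "Pow {1..N}"]) (auto simp: kneser_graph_def)
  have "parcs (kneser_graph N n) \<subseteq> pverts (kneser_graph N n) \<times> pverts (kneser_graph N n)"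
    by (auto simp: kneser_graph_def)
  then have "finite (parcs (kneser_graph N n))"
    using fin by (meson finite_SigmaI finite_subset)
  moreover have "symmetric (with_proj (kneser_graph N n))"
    unfolding symmetric_def by (rule symI) (auto simp: kneser_graph_def)
  moreover have "fst e \<noteq> snd e" if "e \<in> parcs (kneser_graph N n)" for e
    using that assms by (cases e) (auto simp: kneser_graph_def)
  ultimately show ?thesis
    using fin by unfold_locales (simp_all add: kneser_graph_def split_beta)
qed

lemma geodetic_interval_subset_verts: "geodetic_interval G u v \<subseteq> verts G"
  by (auto simp: geodetic_interval_def shortest_path_def path_betw_def vpath_def vwalk_def)

lemma geodetic_closure_superset:
  assumes "W \<subseteq> verts G"
  shows "W \<subseteq> geodetic_closure G W"
proof
  fix w assume w: "w \<in> W"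
  then have "shortest_path G w [w] w"
    using assms by (auto simp: shortest_path_def path_betw_def vpath_def vwalk_def)
  then have "w \<in> geodetic_interval G w w"
    unfolding geodetic_interval_def by (intro CollectI exI[of _ "[w]"]) simp
  with w show "w \<in> geodetic_closure G W"
    by (auto simp: geodetic_closure_def)
qed

lemma geodetically_convex_verts: "geodetically_convex G (verts G)"
proof -
  have "geodetic_closure G (verts G) \<subseteq> verts G"
    unfolding geodetic_closure_def by (intro UN_least geodetic_interval_subset_verts)
  with geodetic_closure_superset[of "verts G" G] show ?thesis
    by (simp add: geodetically_convex_def)
qed

text \<open>The intersection defining the hull is itself convex, hence the smallest convex
  set containing \<^term>\<open>W\<close>.\<close>

lemma geodetically_convex_hull:
  assumes "W \<subseteq> verts G"
  shows "geodetically_convex G (geodetic_hull G W)"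
proof -
  have sub: "geodetic_hull G W \<subseteq> verts G"
    using geodetically_convex_verts[of G] assms by (auto simp: geodetic_hull_def)
  have "geodetic_closure G (geodetic_hull G W) \<subseteq> C"
    if "geodetically_convex G C" "W \<subseteq> C" for C
  proof -
    have "geodetic_hull G W \<subseteq> C"
      using that by (auto simp: geodetic_hull_def)
    then have "geodetic_closure G (geodetic_hull G W) \<subseteq> geodetic_closure G C"
      by (auto simp: geodetic_closure_def)
    with that show ?thesis
      by (simp add: geodetically_convex_def)
  qed
  then have "geodetic_closure G (geodetic_hull G W) \<subseteq> geodetic_hull G W"
    by (auto simp: geodetic_hull_def)
  with sub geodetic_closure_superset[OF sub] show ?thesis
    by (auto simp: geodetically_convex_def)
qed

lemma geodetic_hull_set_verts: "geodetic_hull_set G (verts G)"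
  using geodetically_convex_verts[of G]
  by (auto simp: geodetic_hull_set_def geodetic_hull_def geodetically_convex_def)

end

theory Submission
  imports Defs
begin

text \<open>Since \<open>k \<ge> n - 1\<close>, the diameter is 2, so a set \<open>C\<close> of vertices is convex iff for
  distinct intersecting \<open>u, v \<in> C\<close> every \<open>n\<close>-subset of the complement of \<open>u \<union> v\<close> lies in \<open>C\<close>.
  Call \<open>U\<close> full if all its \<open>n\<close>-subsets lie in \<open>C\<close>. If \<open>T\<close> is full and \<open>|T| = n + 1\<close>, then the
  complement of \<open>T\<close> is full.

  For \<open>k \<ge> 3\<close>, two vertices with union of size \<open>n + 1\<close> suffice: passing twice to complements
  exchanges one element of the \<open>(n + 1)\<close>-set for another, because the union of both
  \<open>(n + 1)\<close>-sets misses at least \<open>n + 1\<close> points.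

  For \<open>k \<le> 2\<close>, the hull of \<open>u, v\<close> only contains subsets of \<open>A\<close> and subsets of the complement of
  \<open>A\<close>, where \<open>A = u \<union> v\<close> (or \<open>A = u\<close> if \<open>u, v\<close> are disjoint), so it is not everything. For
  \<open>k = 2\<close> complements of full \<open>(n + 1)\<close>-sets have again size \<open>n + 1\<close>; hence a full set can be
  enlarged by a point \<open>y\<close> as soon as one \<open>w \<in> C\<close> exceeds it exactly by \<open>y\<close>. The case \<open>k = 1\<close> is
  the Petersen graph.\<close>

section \<open>Geodetic convexity in Kneser graphs\<close>

definition full :: "nat \<Rightarrow> 'a set set \<Rightarrow> 'a set \<Rightarrow> bool" where
  "full n C U \<longleftrightarrow> (\<forall>s. s \<subseteq> U \<and> card s = n \<longrightarrow> s \<in> C)"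

text \<open>The \<open>n\<close>-subsets missing \<open>u \<union> v\<close> are the common
  neighbours of \<open>u\<close> and \<open>v\<close>, so this is convexity at distance two, stated
  without paths. Equal or adjacent vertices have nothing strictly between them.\<close>

definition kneser_closed :: "nat \<Rightarrow> nat \<Rightarrow> nat set set \<Rightarrow> bool" where
  "kneser_closed N n C \<longleftrightarrow>
    (\<forall>u\<in>C. \<forall>v\<in>C. u \<noteq> v \<and> u \<inter> v \<noteq> {} \<longrightarrow> full n C ({1..N} - (u \<union> v)))"

lemma fullD: "full n C U \<Longrightarrow> s \<subseteq> U \<Longrightarrow> card s = n \<Longrightarrow> s \<in> C"
  by (auto simp: full_def)

lemma full_mono: "full n C U \<Longrightarrow> T \<subseteq> U \<Longrightarrow> full n C T"
  by (auto simp: full_def)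

lemma kneser_closedD:
  "kneser_closed N n C \<Longrightarrow> u \<in> C \<Longrightarrow> v \<in> C \<Longrightarrow> u \<noteq> v \<Longrightarrow> u \<inter> v \<noteq> {}
    \<Longrightarrow> full n C ({1..N} - (u \<union> v))"
  by (auto simp: kneser_closed_def)

lemma pverts_kneser_graph [simp]:
  "pverts (kneser_graph N n) = {u. u \<subseteq> {1..N} \<and> card u = n}"
  by (simp add: kneser_graph_def)

lemma parcs_kneser_graph:
  "parcs (kneser_graph N n) =
    {(u, v). u \<subseteq> {1..N} \<and> card u = n \<and> v \<subseteq> {1..N} \<and> card v = n \<and> u \<inter> v = {}}"
  by (simp add: kneser_graph_def)

lemma common_neighbour_path_betw:
  assumes "n > 0" "u \<noteq> v"
    and "u \<subseteq> {1..N}" "card u = n" "v \<subseteq> {1..N}" "card v = n"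
    and "w \<subseteq> {1..N} - (u \<union> v)" "card w = n"
  shows "path_betw (with_proj (kneser_graph N n)) u [u, w, v] v"
proof -
  have "w \<noteq> {}" "u \<noteq> {}" "v \<noteq> {}" using assms by auto
  then show ?thesis using assms
    by (auto simp: path_betw_def vpath_def vwalk_def parcs_kneser_graph)
qed

text \<open>Distinct intersecting vertices are not adjacent, so a path through a common neighbour is
  already shortest. No bound on \<open>N\<close> enters in this direction.\<close>

lemma convex_imp_kneser_closed:
  assumes "n > 0" and conv: "geodetically_convex (with_proj (kneser_graph N n)) C"
  shows "kneser_closed N n C"
  unfolding kneser_closed_def full_def
proof (intro ballI allI impI)
  let ?G = "with_proj (kneser_graph N n)"
  fix u v w
  assume uv: "u \<in> C" "v \<in> C" "u \<noteq> v \<and> u \<inter> v \<noteq> {}"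
    and w: "w \<subseteq> {1..N} - (u \<union> v) \<and> card w = n"
  have C: "C \<subseteq> {u. u \<subseteq> {1..N} \<and> card u = n}" "geodetic_closure ?G C = C"
    using conv by (auto simp: geodetically_convex_def)
  have p: "path_betw ?G u [u, w, v] v"
    using uv w C(1) \<open>n > 0\<close> by (intro common_neighbour_path_betw) auto
  have "2 \<le> length q - 1" if q: "path_betw ?G u q v" for q
  proof (rule ccontr)
    assume "\<not> 2 \<le> length q - 1"
    moreover have "q \<noteq> []" using q by (auto simp: path_betw_def vpath_def vwalk_def)
    ultimately have "length q = 1 \<or> length q = 2"
      using length_greater_0_conv[of q] by linarith
    then consider x where "q = [x]" | x y where "q = [x, y]"
      by (auto simp: length_Suc_conv eval_nat_numeral)
    then show False
      using q uv by cases (auto simp: path_betw_def vpath_def vwalk_def parcs_kneser_graph)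
  qed
  with p have "shortest_path ?G u [u, w, v] v"
    by (simp add: shortest_path_def numeral_2_eq_2)
  then have "w \<in> geodetic_interval ?G u v"
    unfolding geodetic_interval_def by (intro CollectI exI[of _ "[u, w, v]"]) simp
  with uv C(2) show "w \<in> C" by (auto simp: geodetic_closure_def)
qed

text \<open>For distinct intersecting vertices, \<open>u \<union> v\<close> has at most
  \<open>2 * n - 1\<close> points and misses at least \<open>k + 1 \<ge> n\<close>. A common
  neighbour therefore exists, and every shortest path has at most one inner vertex.\<close>

lemma kneser_closed_imp_convex:
  assumes "n > 0" "k \<ge> n - 1"
    and C: "C \<subseteq> {u. u \<subseteq> {1..2 * n + k} \<and> card u = n}"
    and closed: "kneser_closed (2 * n + k) n C"
  shows "geodetically_convex (with_proj (kneser_graph (2 * n + k) n)) C"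
proof -
  let ?N = "2 * n + k"
  let ?G = "with_proj (kneser_graph ?N n)"
  have "geodetic_closure ?G C \<subseteq> C"
  proof
    fix w assume "w \<in> geodetic_closure ?G C"
    then obtain u v p where uv: "u \<in> C" "v \<in> C" and w: "w \<in> set p"
      and p: "path_betw ?G u p v"
      and min: "\<And>q. path_betw ?G u q v \<Longrightarrow> length p - 1 \<le> length q - 1"
      by (auto simp: geodetic_closure_def geodetic_interval_def shortest_path_def)
    have u: "u \<subseteq> {1..?N}" "card u = n" and v: "v \<subseteq> {1..?N}" "card v = n"
      using uv C by auto
    have p_ne: "p \<noteq> []" "hd p = u" "last p = v" "distinct p"
      and arcs: "set (vwalk_arcs p) \<subseteq> arcs_ends ?G"
      using p by (auto simp: path_betw_def vpath_def vwalk_def)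
    consider "u = v" | "u \<noteq> v" "u \<inter> v = {}" | "u \<noteq> v" "u \<inter> v \<noteq> {}" by blast
    then show "w \<in> C"
    proof cases
      case 1
      then have "path_betw ?G u [u] v"
        using u by (auto simp: path_betw_def vpath_def vwalk_def)
      from min[OF this] have "p = [u]"
        using p_ne by (cases p) auto
      with w uv show ?thesis by auto
    next
      case 2
      then have "path_betw ?G u [u, v] v"
        using u v by (auto simp: path_betw_def vpath_def vwalk_def parcs_kneser_graph)
      from min[OF this] have "set p \<subseteq> {u, v}"
        using p_ne by (cases p rule: vwalk_arcs.cases) auto
      with w uv show ?thesis by auto
    next
      case 3
      have fin: "finite u" "finite v" using u v finite_subset by blast+
      then have "card (u \<inter> v) > 0" using 3 by (simp add: card_gt_0_iff)
      then have "card (u \<union> v) + 1 \<le> 2 * n"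
        using card_Un_Int[OF fin] u v by simp
      then have "n \<le> card ({1..?N} - (u \<union> v))"
        using u v fin assms by (subst card_Diff_subset) auto
      then obtain x where "x \<subseteq> {1..?N} - (u \<union> v)" "card x = n"
        by (metis obtain_subset_with_card_n)
      then have "path_betw ?G u [u, x, v] v"
        using 3 u v \<open>n > 0\<close> by (intro common_neighbour_path_betw) auto
      from min[OF this] have len: "length p - 1 \<le> 2" by simp
      have "w = u \<or> w = v \<or> (w \<subseteq> {1..?N} - (u \<union> v) \<and> card w = n)"
      proof -
        have "length p = 1 \<or> length p = 2 \<or> length p = 3"
          using len length_greater_0_conv[of p] p_ne(1) by linarith
        then consider x where "p = [x]" | x y where "p = [x, y]" | x y z where "p = [x, y, z]"
          by (auto simp: length_Suc_conv eval_nat_numeral)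
        then show ?thesis
          using w p_ne(2,3) arcs by cases (auto simp: parcs_kneser_graph)
      qed
      moreover have "full n C ({1..?N} - (u \<union> v))"
        using kneser_closedD[OF closed] uv 3 by blast
      ultimately show ?thesis using uv by (auto dest: fullD)
    qed
  qed
  with geodetic_closure_superset[of C ?G] C show ?thesis
    by (auto simp: geodetically_convex_def)
qed

lemma hull_setI:
  assumes "n > 0" "W \<subseteq> {u. u \<subseteq> {1..N} \<and> card u = n}"
    and full: "\<And>C. kneser_closed N n C \<Longrightarrow> W \<subseteq> C \<Longrightarrow> full n C {1..N}"
  shows "geodetic_hull_set (with_proj (kneser_graph N n)) W"
proof -
  let ?G = "with_proj (kneser_graph N n)"
  have "geodetic_hull ?G W \<subseteq> verts ?G"
    using geodetically_convex_verts[of ?G] assms(2) by (auto simp: geodetic_hull_def)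
  moreover have "verts ?G \<subseteq> C" if "geodetically_convex ?G C" "W \<subseteq> C" for C
    using full[OF convex_imp_kneser_closed[OF \<open>n > 0\<close> that(1)] that(2)] by (auto dest: fullD)
  ultimately show ?thesis
    using assms(2) by (auto simp: geodetic_hull_set_def geodetic_hull_def)
qed

section \<open>Lower bounds\<close>

text \<open>Since \<open>n \<ge> 2\<close>, some vertex contains both \<open>x\<close> and
  \<open>y\<close>. It crosses the border of \<open>A\<close>, so the convex set \<open>C\<close>
  omits it.\<close>

lemma not_hull_setI:
  assumes "n \<ge> 2" "k \<ge> n - 1"
    and C: "C \<subseteq> {u. u \<subseteq> {1..2 * n + k} \<and> card u = n}"
    and closed: "kneser_closed (2 * n + k) n C" and W: "W \<subseteq> C"
    and A: "x \<in> A" "x \<in> {1..2 * n + k}" "y \<notin> A" "y \<in> {1..2 * n + k}"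
    and split: "\<And>s. s \<in> C \<Longrightarrow> s \<subseteq> A \<or> s \<inter> A = {}"
  shows "\<not> geodetic_hull_set (with_proj (kneser_graph (2 * n + k) n)) W"
proof
  assume "geodetic_hull_set (with_proj (kneser_graph (2 * n + k) n)) W"
  moreover have "geodetically_convex (with_proj (kneser_graph (2 * n + k) n)) C"
    using kneser_closed_imp_convex C closed assms(1,2) by simp
  ultimately have all: "{u. u \<subseteq> {1..2 * n + k} \<and> card u = n} \<subseteq> C"
    using W by (auto simp: geodetic_hull_set_def geodetic_hull_def)
  have "x \<noteq> y" using A by auto
  then have "n - 2 \<le> card ({1..2 * n + k} - {x, y})"
    using A by (subst card_Diff_subset) auto
  then obtain r where r: "r \<subseteq> {1..2 * n + k} - {x, y}" "card r = n - 2" "finite r"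
    by (metis obtain_subset_with_card_n)
  then have "card (insert x (insert y r)) = n"
    using \<open>x \<noteq> y\<close> \<open>n \<ge> 2\<close> by (subst card_insert_disjoint; force)+
  then have "insert x (insert y r) \<in> C" using r A all by auto
  from split[OF this] A show False by auto
qed

text \<open>Without two distinct intersecting members, \<open>{u, v}\<close> is closed as it stands;
  \<open>A = u\<close> separates its members.\<close>

lemma trivial_pair_not_hull_set:
  assumes "n \<ge> 2" "k \<ge> n - 1"
    and u: "u \<subseteq> {1..2 * n + k}" "card u = n" and v: "v \<subseteq> {1..2 * n + k}" "card v = n"
    and uv: "u = v \<or> u \<inter> v = {}" and W: "W \<subseteq> {u, v}"
  shows "\<not> geodetic_hull_set (with_proj (kneser_graph (2 * n + k) n)) W"
proof -
  let ?N = "2 * n + k"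
  have "finite u" using u finite_subset by blast
  have "u \<noteq> {}" using u \<open>n \<ge> 2\<close> by auto
  then obtain x where x: "x \<in> u" by blast
  have "card u < card {1..?N}" using u \<open>n \<ge> 2\<close> by simp
  then have "\<not> {1..?N} \<subseteq> u" using \<open>finite u\<close> by (meson card_mono leD)
  then obtain y where y: "y \<in> {1..?N}" "y \<notin> u" by blast
  show ?thesis
  proof (rule not_hull_setI[of n k "{u, v}" W x u y])
    show "kneser_closed ?N n {u, v}" using uv by (auto simp: kneser_closed_def)
  qed (use assms x y in auto)
qed

lemma pair_not_hull_set:
  assumes "n \<ge> 2" "k > 0" "k \<ge> n - 1" "k \<le> 2"
    and u: "u \<subseteq> {1..2 * n + k}" "card u = n" and v: "v \<subseteq> {1..2 * n + k}" "card v = n"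
    and W: "W \<subseteq> {u, v}"
  shows "\<not> geodetic_hull_set (with_proj (kneser_graph (2 * n + k) n)) W"
proof -
  let ?N = "2 * n + k"
  have fin: "finite u" "finite v" using u v finite_subset by blast+
  have "u \<noteq> {}" using u \<open>n \<ge> 2\<close> by auto
  then obtain x where x: "x \<in> u" by blast
  show ?thesis
  proof (cases "u = v \<or> u \<inter> v = {}")
    case True
    then show ?thesis using trivial_pair_not_hull_set[OF assms(1,3) u v _ W] by blast
  next
    case False
    let ?A = "u \<union> v" and ?B = "{1..?N} - (u \<union> v)"
    have card: "card ?A + card (u \<inter> v) = 2 * n" using card_Un_Int[OF fin] u v by simp
    have "card (u \<inter> v) > 0" using False fin by (simp add: card_gt_0_iff)
    have "card (u \<inter> v) < n"
    proof -
      have "u \<inter> v \<subset> u" using False u v fin by (metis card_subset_eq inf.cobounded1 inf.cobounded2 psubsetI)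
      then show ?thesis using psubset_card_mono[OF fin(1)] u by simp
    qed
    have cardB: "card ?B = k + card (u \<inter> v)"
      using card u v fin by (subst card_Diff_subset) auto
    then have "card ?B > 0" using \<open>k > 0\<close> by simp
    then have "?B \<noteq> {}" by (metis card.empty less_irrefl)
    then obtain y where y: "y \<in> ?B" by blast
    \<comment> \<open>From \<open>1 \<le> card (u \<inter> v) \<le> n - 1\<close> and
      \<open>n - 1 \<le> k \<le> 2\<close>, the size of \<open>?B\<close> is \<open>n\<close> or
      \<open>n + 1\<close>.\<close>
    show ?thesis
    proof (cases "card ?B = n")
      case True
      have "full n {u, v, ?B} ?B"
        unfolding full_def using True
        by (metis card_subset_eq finite_Diff finite_atLeastAtMost insertCI)
      \<comment> \<open>\<open>?B\<close> is disjoint from \<open>u\<close> and \<open>v\<close>, so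
        the only pair to consider is \<open>u, v\<close> itself.\<close>
      moreover have "s \<union> t = u \<union> v" if "s \<in> {u, v, ?B}" "t \<in> {u, v, ?B}" "s \<noteq> t" "s \<inter> t \<noteq> {}" for s t
        using that by blast
      ultimately have "kneser_closed ?N n {u, v, ?B}"
        unfolding kneser_closed_def by metis
      then show ?thesis
        using assms x y True
        by (intro not_hull_setI[of n k "{u, v, ?B}" W x ?A y]) auto
    next
      case False
      \<comment> \<open>Here \<open>k = 2\<close> and both \<open>A\<close> and \<open>B\<close> have size \<open>n + 1\<close>, so two distinct \<open>n\<close>-subsets of
        either one have that set as their union.\<close>
      have cB: "card ?B = n + 1" and cA: "card ?A = n + 1"
        using False cardB card assms \<open>card (u \<inter> v) > 0\<close> \<open>card (u \<inter> v) < n\<close> by linarith+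
      let ?C = "{s. card s = n \<and> (s \<subseteq> ?A \<or> s \<subseteq> ?B)}"
      have union: "s \<union> t = X"
        if "s \<subseteq> X" "t \<subseteq> X" "card s = n" "card t = n" "s \<noteq> t" "card X = n + 1" for s t X :: "nat set"
      proof -
        have "finite X" using that(6) card.infinite by fastforce
        then have f: "finite s" "finite t" "finite (s \<union> t)" using that finite_subset by blast+
        have "card (s \<union> t) \<noteq> n"
          using that f by (metis card_subset_eq sup.cobounded1 sup.cobounded2)
        moreover have "card s \<le> card (s \<union> t)" using f by (simp add: card_mono)
        moreover have "card (s \<union> t) \<le> card X"
          using that(1,2) \<open>finite X\<close> by (intro card_mono) auto
        ultimately have "card (s \<union> t) = card X" using that by simp
        then show ?thesis using that \<open>finite X\<close> by (simp add: card_subset_eq)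
      qed
      have "full n ?C ({1..?N} - (s \<union> t))"
        if "s \<in> ?C" "t \<in> ?C" "s \<noteq> t" "s \<inter> t \<noteq> {}" for s t
      proof -
        have "s \<union> t = ?A \<or> s \<union> t = ?B"
          using that union[of s ?A t] union[of s ?B t] cA cB by blast
        then have "{1..?N} - (s \<union> t) = ?B \<or> {1..?N} - (s \<union> t) = ?A"
          using u v by auto
        then show ?thesis by (auto simp: full_def)
      qed
      then have "kneser_closed ?N n ?C" by (simp add: kneser_closed_def)
      then show ?thesis
        using assms x y
        by (intro not_hull_setI[of n k ?C W x ?A y]) auto
    qed
  qed
qed

lemma hull_set_card_ge_3:
  assumes "n \<ge> 2" "k > 0" "k \<ge> n - 1" "k \<le> 2"
    and W: "geodetic_hull_set (with_proj (kneser_graph (2 * n + k) n)) W" "finite W"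
  shows "card W \<ge> 3"
proof (rule ccontr)
  let ?V = "{u. u \<subseteq> {1..2 * n + k} \<and> card u = n}"
  assume "\<not> card W \<ge> 3"
  then consider "card W = 0" | "card W = 1" | "card W = 2" by linarith
  then consider "W = {}" | u where "W = {u}" | u v where "W = {u, v}"
    using \<open>finite W\<close> by cases (simp, metis card_1_singletonE, metis card_2_iff)
  \<comment> \<open>The vertex \<open>{1..n}\<close> pads an empty \<open>W\<close>.\<close>
  moreover have "W \<subseteq> ?V" "{1..n} \<in> ?V" using W(1) by (auto simp: geodetic_hull_set_def)
  ultimately have "\<exists>u\<in>?V. \<exists>v\<in>?V. W \<subseteq> {u, v}" by cases blast+
  then obtain u v where "u \<in> ?V" "v \<in> ?V" "W \<subseteq> {u, v}" by blast
  then show False using pair_not_hull_set[OF assms(1-4), of u v W] W(1) by simp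
qed

lemma hull_set_card_ge_2:
  assumes "n \<ge> 2" "k > 0" "k \<ge> n - 1"
    and W: "geodetic_hull_set (with_proj (kneser_graph (2 * n + k) n)) W" "finite W"
  shows "card W \<ge> 2"
proof (rule ccontr)
  let ?V = "{u. u \<subseteq> {1..2 * n + k} \<and> card u = n}"
  assume "\<not> card W \<ge> 2"
  then consider "card W = 0" | "card W = 1" by linarith
  then consider "W = {}" | u where "W = {u}"
    using \<open>finite W\<close> by cases (simp, metis card_1_singletonE)
  moreover have "W \<subseteq> ?V" "{1..n} \<in> ?V" using W(1) by (auto simp: geodetic_hull_set_def)
  ultimately have "\<exists>u\<in>?V. W \<subseteq> {u}" by cases blast+
  then obtain u where "u \<in> ?V" "W \<subseteq> {u}" by blast
  then show False using trivial_pair_not_hull_set[OF assms(1,3), of u u W] W(1) by simp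
qed

section \<open>Small hull sets\<close>

text \<open>Connectedness of the Johnson graph as an induction rule: swapping a point of
  \<open>A - B\<close> for one of \<open>B - A\<close> lowers \<open>card (B - A)\<close> by
  one.\<close>

lemma exchange_induct:
  assumes "finite X" "A \<subseteq> X" "B \<subseteq> X" "card A = card B" "P A"
    and step: "\<And>S a b. S \<subseteq> X \<Longrightarrow> card S = card B \<Longrightarrow> P S \<Longrightarrow> a \<in> S \<Longrightarrow> b \<in> X - S
      \<Longrightarrow> P (insert b (S - {a}))"
  shows "P B"
  using assms(2,4,5)
proof (induction "card (B - A)" arbitrary: A)
  case 0
  then have "B \<subseteq> A" using assms(1,3) finite_subset by fastforce
  then have "B = A" using 0 assms(1) by (metis card_subset_eq finite_subset)
  with 0 show ?case by simp
next
  case (Suc m)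
  have fin: "finite A" "finite B" using Suc assms finite_subset by blast+
  obtain b where b: "b \<in> B - A" using Suc by (metis card.empty ex_in_conv nat.distinct(1))
  then have "\<not> A \<subseteq> B" using Suc fin by (metis DiffE card_subset_eq)
  then obtain a where a: "a \<in> A - B" by blast
  let ?A' = "insert b (A - {a})"
  have "B - A = insert b (B - ?A')" "b \<notin> B - ?A'" using a b by auto
  then have "m = card (B - ?A')" using Suc(2) fin by simp
  moreover have "card ?A' = card B"
    using a b fin Suc by (metis DiffD1 DiffD2 card.remove card_insert_disjoint finite_Diff)
  moreover have "P ?A'" using Suc a b assms(3) by (intro step) auto
  moreover have "?A' \<subseteq> X" using Suc a b assms(3) by auto
  ultimately show ?case using Suc(1) by blast
qed

text \<open>Two sets \<open>T - {a}\<close> and \<open>T - {b}\<close> lie in \<open>C\<close> and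
  have union \<open>T\<close>. As \<open>T\<close> has at least three points, a third point
  \<open>c\<close> makes them intersect.\<close>

lemma full_Compl:
  assumes "n \<ge> 2" and closed: "kneser_closed N n C" and "card T = n + 1" "full n C T"
  shows "full n C ({1..N} - T)"
proof -
  have "\<exists>a b c. {a, b, c} \<subseteq> T \<and> card {a, b, c} = 3"
  proof -
    have "3 \<le> card T" using assms by simp
    then obtain R where "R \<subseteq> T" "card R = 3" by (metis obtain_subset_with_card_n)
    then show ?thesis by (metis card_3_iff)
  qed
  then obtain a b c where abc: "{a, b, c} \<subseteq> T" "card {a, b, c} = 3" by blast
  then have ne: "a \<noteq> b" "a \<noteq> c" "b \<noteq> c" by (auto simp: card_insert_if split: if_splits)
  have "T - {a} \<in> C" "T - {b} \<in> C"
    using abc assms by (auto intro!: fullD[OF assms(4)])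
  moreover have "T - {a} \<noteq> T - {b}" "(T - {a}) \<inter> (T - {b}) \<noteq> {}" "(T - {a}) \<union> (T - {b}) = T"
    using abc ne by auto
  ultimately show ?thesis using kneser_closedD[OF closed] by metis
qed

lemma full_if_k_ge_3:
  assumes "n \<ge> 2" "k \<ge> 3" and closed: "kneser_closed (2 * n + k) n C"
    and W: "{1..n} \<in> C" "{2..n + 1} \<in> C"
  shows "full n C {1..2 * n + k}"
  unfolding full_def
proof (intro allI impI, elim conjE)
  let ?X = "{1..2 * n + k}"
  fix s assume s: "s \<subseteq> ?X" "card s = n"
  have un: "{1..n} \<union> {2..n + 1} = {1..n + 1}" using \<open>n \<ge> 2\<close> by auto
  have "1 \<in> {1..n}" "1 \<notin> {2..n + 1}" "2 \<in> {1..n} \<inter> {2..n + 1}" using \<open>n \<ge> 2\<close> by auto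
  then have base: "full n C (?X - {1..n + 1})"
    using kneser_closedD[OF closed W] un by (metis empty_iff)
  \<comment> \<open>The exchange carries fullness of the complement, which \<open>base\<close>
    provides for \<open>{1..n + 1}\<close>.\<close>
  have compl: "full n C (?X - T)" if "T \<subseteq> ?X" "card T = n + 1" for T
  proof (rule exchange_induct[of ?X "{1..n + 1}" T "\<lambda>T. full n C (?X - T)"])
    fix S a b assume S: "S \<subseteq> ?X" "card S = card T" "full n C (?X - S)" "a \<in> S" "b \<in> ?X - S"
    have "finite S" using S finite_subset by blast
    then have "card (insert b S) = n + 2" using S that by simp
    \<comment> \<open>Here \<open>k \<ge> 3\<close> is decisive: \<open>n + k - 2\<close> points lie
      outside \<open>insert b S\<close>, enough for an \<open>(n + 1)\<close>-set \<open>M\<close>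
      avoiding both \<open>S\<close> and the exchanged set.\<close>
    then have "n + 1 \<le> card (?X - insert b S)"
      using S \<open>k \<ge> 3\<close> \<open>finite S\<close> by (subst card_Diff_subset) auto
    then obtain M where M: "M \<subseteq> ?X - insert b S" "card M = n + 1"
      by (metis obtain_subset_with_card_n)
    have "full n C M" using S(3) M by (auto intro: full_mono)
    then have "full n C (?X - M)" using full_Compl[OF \<open>n \<ge> 2\<close> closed] M by blast
    moreover have "insert b (S - {a}) \<subseteq> ?X - M" using S M by auto
    ultimately have "full n C (insert b (S - {a}))" by (rule full_mono)
    moreover have "card (insert b (S - {a})) = n + 1"
      using S that \<open>finite S\<close> by simp
    ultimately show "full n C (?X - insert b (S - {a}))"
      using full_Compl[OF \<open>n \<ge> 2\<close> closed] by blast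
  qed (use that base \<open>n \<ge> 2\<close> in auto)
  have "finite s" using s finite_subset by blast
  then have "n + 1 \<le> card (?X - s)" using s \<open>k \<ge> 3\<close> by (subst card_Diff_subset) auto
  then obtain T where T: "T \<subseteq> ?X - s" "card T = n + 1" by (metis obtain_subset_with_card_n)
  then have "full n C (?X - T)" by (intro compl) auto
  then show "s \<in> C" using s T by (auto intro: fullD)
qed

text \<open>Starting at \<open>w\<close>, all \<open>n\<close>-sets made of \<open>y\<close> and
  points of \<open>F\<close> are reached by exchanges that keep \<open>y\<close> fixed.\<close>

lemma full_insert:
  assumes "n \<ge> 2" and closed: "kneser_closed (2 * n + 2) n C"
    and F: "F \<subseteq> {1..2 * n + 2}" "full n C F"
    and w: "w \<in> C" "card w = n" "w - F = {y}" and y: "y \<in> {1..2 * n + 2}"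
  shows "full n C (insert y F)"
  unfolding full_def
proof (intro allI impI, elim conjE)
  let ?X = "{1..2 * n + 2}"
  fix s assume s: "s \<subseteq> insert y F" "card s = n"
  show "s \<in> C"
  proof (cases "y \<in> s")
    case False
    then show ?thesis using s F by (auto intro: fullD)
  next
    case True
    have yF: "y \<notin> F" "y \<in> w" using w by auto
    have finF: "finite F" using F finite_subset by blast
    have fin: "finite w" "finite s" using w s \<open>n \<ge> 2\<close> card.infinite by fastforce+
    have "insert y (s - {y}) \<in> C"
    proof (rule exchange_induct[of F "w - {y}" "s - {y}" "\<lambda>r. insert y r \<in> C"])
      fix S a b assume S: "S \<subseteq> F" "card S = card (s - {y})" "insert y S \<in> C" "a \<in> S" "b \<in> F - S"
      have cS: "card S = n - 1" and fS: "finite S"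
        using S s True finF finite_subset by auto
      let ?T = "insert y (insert b S)"
      have cT: "card ?T = n + 1" using S cS fS yF \<open>n \<ge> 2\<close> by (auto simp: card_insert_if)
      have TX: "?T \<subseteq> ?X" using S F y by auto
      \<comment> \<open>One exchange: \<open>insert b S\<close> lies in \<open>C\<close> because
        \<open>F\<close> is full. Together with \<open>insert y S\<close> it spans
        \<open>?T\<close>, and complementing twice makes \<open>?T\<close>, which contains the
        exchanged set, full.\<close>
      have "insert b S \<in> C" using S cS fS \<open>n \<ge> 2\<close> by (auto intro!: fullD[OF F(2)])
      moreover have "insert b S \<noteq> insert y S" "insert b S \<inter> insert y S \<noteq> {}"
        "insert b S \<union> insert y S = ?T"
        using S yF by auto
      ultimately have "full n C (?X - ?T)"
        using kneser_closedD[OF closed _ S(3)] by metis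
      moreover have "card (?X - ?T) = n + 1"
        using cT TX fS by (subst card_Diff_subset) auto
      ultimately have "full n C (?X - (?X - ?T))"
        using full_Compl[OF \<open>n \<ge> 2\<close> closed] by blast
      then have "full n C ?T" using TX by (simp add: double_diff)
      moreover have "card (insert y (insert b (S - {a}))) = n"
        using S cS fS yF \<open>n \<ge> 2\<close> by (auto simp: card_insert_if)
      ultimately show "insert y (insert b (S - {a})) \<in> C"
        by (auto intro: fullD)
    qed (use finF w s True yF fin in \<open>auto simp: insert_absorb\<close>)
    then show ?thesis using True by (simp add: insert_absorb)
  qed
qed

text \<open>The third vertex enlarges the full set \<open>{1..n + 1}\<close> to \<open>?F\<close>.
  Complements of its \<open>(n + 1)\<close>-subsets carry fullness over to \<open>?V\<close>, and
  then the points of \<open>?F\<close> are added to \<open>?V\<close> one at a time.\<close>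

lemma full_if_k_eq_2:
  assumes "n \<ge> 2" and closed: "kneser_closed (2 * n + 2) n C"
    and W: "{1..n} \<in> C" "{2..n + 1} \<in> C" "{3..n + 2} \<in> C"
  shows "full n C {1..2 * n + 2}"
proof -
  let ?X = "{1..2 * n + 2}" and ?F = "{1..n + 2}" and ?V = "{n + 3..2 * n + 2}"
  have un: "{1..n} \<union> {2..n + 1} = {1..n + 1}" using \<open>n \<ge> 2\<close> by auto
  have "1 \<in> {1..n}" "1 \<notin> {2..n + 1}" "2 \<in> {1..n} \<inter> {2..n + 1}" using \<open>n \<ge> 2\<close> by auto
  then have "full n C (?X - {1..n + 1})"
    using kneser_closedD[OF closed W(1,2)] un by (metis empty_iff)
  moreover have "card (?X - {1..n + 1}) = n + 1"
    by (subst card_Diff_subset) auto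
  ultimately have "full n C (?X - (?X - {1..n + 1}))"
    using full_Compl[OF \<open>n \<ge> 2\<close> closed] by blast
  moreover have "?X - (?X - {1..n + 1}) = {1..n + 1}" by auto
  ultimately have "full n C {1..n + 1}" by simp
  then have "full n C (insert (n + 2) {1..n + 1})"
    by (intro full_insert[OF \<open>n \<ge> 2\<close> closed _ _ W(3)]) (use \<open>n \<ge> 2\<close> in auto)
  moreover have "insert (n + 2) {1..n + 1} = ?F" by auto
  ultimately have F: "full n C ?F" by simp
  have V: "full n C (insert a ?V)" if "a \<in> ?F" for a
  proof -
    have "full n C (?F - {a})" using F by (auto intro: full_mono)
    then have "full n C (?X - (?F - {a}))"
      using full_Compl[OF \<open>n \<ge> 2\<close> closed] that by simp
    moreover have "?X - (?F - {a}) = insert a ?V" using that by auto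
    ultimately show ?thesis by simp
  qed
  have "full n C (H \<union> ?V)" if "finite H" "H \<noteq> {}" "H \<subseteq> ?F" for H
    using that
  proof (induction rule: finite_ne_induct)
    case (singleton a)
    then show ?case using V[of a] by simp
  next
    case (insert b H)
    \<comment> \<open>Dropping \<open>n + 3\<close> from the \<open>n\<close> points of
      \<open>?V\<close> leaves room for \<open>b\<close>, the only point of \<open>?w\<close>
      outside \<open>H \<union> ?V\<close>.\<close>
    let ?w = "insert b (?V - {n + 3})"
    have "card ?w = n" using insert \<open>n \<ge> 2\<close> by auto
    moreover from this have "?w \<in> C" using V[of b] insert by (auto intro: fullD)
    moreover have "?w - (H \<union> ?V) = {b}" using insert by auto
    moreover have "H \<union> ?V \<subseteq> ?X" using insert by auto
    moreover have "full n C (H \<union> ?V)" using insert by auto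
    moreover have "b \<in> ?X" using insert by auto
    ultimately have "full n C (insert b (H \<union> ?V))"
      by (intro full_insert[OF \<open>n \<ge> 2\<close> closed])
    then show ?case by simp
  qed
  from this[of ?F] have "full n C (?F \<union> ?V)" by auto
  moreover have "?F \<union> ?V = ?X" by auto
  ultimately show ?thesis by simp
qed

text \<open>Two distinct intersecting pairs in \<open>{1..5}\<close> have exactly one common
  neighbour. Three pairs through \<open>1\<close> yield those joining \<open>5\<close> to
  \<open>2\<close>, \<open>3\<close>, \<open>4\<close>, then the pairs within
  \<open>{2, 3, 4}\<close>, and finally \<open>{1, 5}\<close>.\<close>

lemma full_petersen:
  assumes closed: "kneser_closed 5 2 C" and W: "{1, 2} \<in> C" "{1, 3} \<in> C" "{1, 4} \<in> C"
  shows "full 2 C {1..5}"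
proof -
  have X: "{1..5} = {1, 2, 3, 4, 5 :: nat}" by auto
  have step: "{d, e} \<in> C"
    if "{a, b} \<in> C" "{a, c} \<in> C" "distinct [a, b, c, d, e]" "{d, e} \<subseteq> {1..5}" for a b c d e
    using that by (intro fullD[OF kneser_closedD[OF closed that(1,2)]]) (auto simp: doubleton_eq_iff)
  have 1: "{4, 5} \<in> C" using step[of 1 2 3 4 5] W by simp
  have 2: "{3, 5} \<in> C" using step[of 1 2 4 3 5] W by simp
  have 3: "{2, 5} \<in> C" using step[of 1 3 4 2 5] W by simp
  have 4: "{2, 3} \<in> C" using step[of 4 5 1 2 3] W 1 by (simp add: insert_commute)
  have 5: "{2, 4} \<in> C" using step[of 3 5 1 2 4] W 2 by (simp add: insert_commute)
  have 6: "{3, 4} \<in> C" using step[of 2 5 1 3 4] W 3 by (simp add: insert_commute)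
  have 7: "{1, 5} \<in> C" using step[of 3 2 4 1 5] 4 6 by (simp add: insert_commute)
  show ?thesis
    unfolding full_def
  proof (intro allI impI, elim conjE)
    fix s assume "s \<subseteq> {1..5 :: nat}" "card s = 2"
    then obtain x y where "s = {x, y}" "x \<noteq> y" "x \<in> {1, 2, 3, 4, 5}" "y \<in> {1, 2, 3, 4, 5}"
      unfolding X by (auto simp: card_2_iff)
    then show "s \<in> C" using W 1 2 3 4 5 6 7 by (auto simp: insert_commute)
  qed
qed

theorem theorem10:
  fixes n k :: nat
  assumes "n \<ge> 2" and "k > 0" and "k \<ge> n - 1"
  shows "(k > 2 \<longrightarrow> ghn (with_proj (kneser_graph (2 * n + k) n)) = 2) \<and>
         (k \<le> 2 \<longrightarrow> ghn (with_proj (kneser_graph (2 * n + k) n)) = 3)"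
proof (intro conjI impI)
  let ?G = "with_proj (kneser_graph (2 * n + k) n)"
  assume "k > 2"
  have "geodetic_hull_set ?G {{1..n}, {2..n + 1}}"
    using full_if_k_ge_3[of n k] assms \<open>k > 2\<close> by (intro hull_setI) auto
  moreover have "{1..n} \<noteq> {2..n + 1}" using \<open>n \<ge> 2\<close> by (auto simp: set_eq_iff intro!: exI[of _ 1])
  then have "card {{1..n}, {2..n + 1}} = 2" by simp
  ultimately show "ghn ?G = 2"
    unfolding ghn_def
    by (intro Least_equality) (use hull_set_card_ge_2[OF assms] in blast)+
next
  let ?G = "with_proj (kneser_graph (2 * n + k) n)"
  assume "k \<le> 2"
  have "\<exists>W. geodetic_hull_set ?G W \<and> finite W \<and> card W = 3"
  proof (cases "k = 2")
    case True
    have "geodetic_hull_set ?G {{1..n}, {2..n + 1}, {3..n + 2}}"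
      using full_if_k_eq_2[of n] assms True by (intro hull_setI) auto
    moreover have "{1..n} \<noteq> {2..n + 1}" "{1..n} \<noteq> {3..n + 2}"
      using \<open>n \<ge> 2\<close> by (auto simp: set_eq_iff intro!: exI[of _ 1])
    moreover have "{2..n + 1} \<noteq> {3..n + 2}"
      using \<open>n \<ge> 2\<close> by (auto simp: set_eq_iff intro!: exI[of _ 2])
    ultimately show ?thesis
      by (intro exI[of _ "{{1..n}, {2..n + 1}, {3..n + 2}}"]) auto
  next
    case False
    \<comment> \<open>With \<open>k = 1\<close>, the bound \<open>k \<ge> n - 1\<close> leaves only
      \<open>n = 2\<close>.\<close>
    then have kn: "k = 1" "n = 2" using \<open>k \<le> 2\<close> assms by auto
    have "geodetic_hull_set ?G {{1, 2}, {1, 3}, {1, 4}}"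
      using full_petersen kn by (intro hull_setI) auto
    moreover have "card {{1, 2}, {1, 3}, {1, 4 :: nat}} = 3"
      by (auto simp: card_insert_if doubleton_eq_iff)
    ultimately show ?thesis by (metis finite.emptyI finite.insertI)
  qed
  then show "ghn ?G = 3"
    unfolding ghn_def
    by (intro Least_equality) (use hull_set_card_ge_3[OF assms \<open>k \<le> 2\<close>] in blast)+
qed

end
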